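(* Let $U, V, W$ be vector spaces over a field $F$ and let $T_1 \colon V \to W$ and $T_2 \colon U \to V$ be linear. There always exist algebraic generalized inverses $G_1$ of $T_1$ and $G_2$ of $T_2$ such that $G_2G_1$ is an algebraic generalized inverse of $T_1T_2$.
   Context: Vector spaces are arbitrary (possibly infinite-dimensional). For a linear map $T\colon V\to W$, a linear map $G\colon W\to V$ is called an algebraic generalized inverse of $T$ if both $TGT=T$ and $GTG=G$ hold. *)

theory Defs
  imports Complex_Main
begin

text \<open>
  A vector space over the field \<open>'k\<close> is a type of class \<open>ab_group_add\<close> with a scalar multiplication
  satisfying the locale \<open>vector_space\<close> of the library, with no restriction on the dimension.
  Note that \<open>Vector_Spaces.linear s t f\<close> includes \<open>vector_space s\<close> and \<open>vector_space t\<close>.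
\<close>

definition alg_gen_inverse ::
  "('k::field \<Rightarrow> 'v::ab_group_add \<Rightarrow> 'v) \<Rightarrow> ('k \<Rightarrow> 'w::ab_group_add \<Rightarrow> 'w) \<Rightarrow>
   ('v \<Rightarrow> 'w) \<Rightarrow> ('w \<Rightarrow> 'v) \<Rightarrow> bool"
  where "alg_gen_inverse sV sW T G \<longleftrightarrow>
    Vector_Spaces.linear sV sW T \<and> Vector_Spaces.linear sW sV G \<and>
    T \<circ> G \<circ> T = T \<and> G \<circ> T \<circ> G = G"

end

theory Submission
  imports Defs
begin

text \<open>
  Let \<open>R\<close> be the range of \<open>T2\<close> and \<open>K\<close> the kernel of \<open>T1\<close>.  There are commuting projections
  \<open>p\<close> onto \<open>R\<close> and \<open>q\<close> onto \<open>K\<close>.  Generalized inverses with \<open>T2 G2 = p\<close> and \<open>G1 T1 = 1 - q\<close>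
  exist, and since these two projections commute,
  \<open>T1 T2 G2 G1 T1 T2 = T1 p (1 - q) T2 = T1 (1 - q) p T2 = T1 T2\<close>, and similarly for the other identity.
\<close>

context vector_space
begin

lemma ex_projection:
  assumes "subspace S"
  shows "\<exists>p. Vector_Spaces.linear scale scale p \<and> (\<forall>x. p x \<in> S) \<and> (\<forall>x\<in>S. p x = x)"
proof -
  interpret vector_space_pair scale scale ..
  \<comment> \<open>A right inverse of the identity on \<open>S\<close>, with values in
    \<open>S\<close>, is a projection onto \<open>S\<close>.\<close>
  obtain p where "range p \<subseteq> S" "Vector_Spaces.linear scale scale p" "\<forall>v\<in>id ` S. id (p v) = v"
    using linear_exists_right_inverse_on[OF linear_id assms] by blast
  then show ?thesis by (intro exI[of _ p]) auto
qed

text \<open>Choosing linearly, for each class modulo \<open>K\<close> that meets \<open>R\<close>, a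
  representative in \<open>R\<close> singles out a complement of \<open>R \<inter> K\<close> in
  \<open>R\<close>. The map \<open>e\<close> projects onto this complement.\<close>

lemma ex_projection_complementing_inter:
  assumes R: "subspace R" and K: "subspace K"
  shows "\<exists>e. Vector_Spaces.linear scale scale e \<and> (\<forall>x. e x \<in> R) \<and> (\<forall>x. e (e x) = e x) \<and>
    (\<forall>x\<in>K. e x = 0) \<and> (\<forall>x\<in>R. x - e x \<in> K)"
proof -
  interpret vector_space_pair scale scale ..
  obtain g where g: "Vector_Spaces.linear scale scale g" "\<And>x. g x \<in> K" "\<And>x. x \<in> K \<Longrightarrow> g x = x"
    using ex_projection[OF K] by blast
  \<comment> \<open>The kernel of \<open>s\<close> is exactly \<open>K\<close>, so \<open>s\<close>
    stands in for the quotient map modulo \<open>K\<close>, and \<open>h\<close> below chooses the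
    representatives in \<open>R\<close>.\<close>
  define s where "s = (\<lambda>x. x - g x)"
  have s: "Vector_Spaces.linear scale scale s"
    unfolding s_def by (intro linear_compose_sub linear_ident g(1))
  obtain h where h: "range h \<subseteq> R" "Vector_Spaces.linear scale scale h"
    and sh: "\<forall>v\<in>s ` R. s (h v) = v"
    using linear_exists_right_inverse_on[OF s R] by blast
  have hR: "h x \<in> R" for x using h(1) by blast
  have shs: "s (h (s x)) = s x" if "x \<in> R" for x using sh that by blast
  \<comment> \<open>\<open>h \<circ> s\<close> need not be idempotent outside \<open>R + K\<close>; inserting \<open>h\<close> and \<open>s\<close> once more repairs this.\<close>
  define e where "e = h \<circ> s \<circ> h \<circ> s"
  have "Vector_Spaces.linear scale scale e"
    unfolding e_def using s h(2) by (metis Vector_Spaces.linear_compose)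
  moreover have "e x \<in> R" for x by (simp add: e_def hR)
  moreover have "e (e x) = e x" for x by (simp add: e_def shs hR)
  moreover have "e x = 0" if "x \<in> K" for x
    using that g(3) by (simp add: e_def s_def linear_0[OF h(2)] linear_0[OF g(1)])
  moreover have "x - e x \<in> K" if "x \<in> R" for x
  proof -
    have "s (x - e x) = 0"
      using that by (simp add: linear_diff[OF s] e_def shs hR)
    then show ?thesis using g(2)[of "x - e x"] by (simp add: s_def)
  qed
  ultimately show ?thesis by blast
qed

text \<open>\<open>R\<close> is the direct sum of the range of \<open>e\<close> and
  \<open>R \<inter> K\<close>, and the range of \<open>e\<close> meets \<open>K\<close> only in 0.
  So \<open>q\<close> can be chosen to kill the range of \<open>e\<close>, and \<open>p\<close> can
  be built from \<open>e\<close> and a part that factors through \<open>q\<close>.\<close>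

lemma ex_commuting_projections:
  assumes R: "subspace R" and K: "subspace K"
  shows "\<exists>p q. Vector_Spaces.linear scale scale p \<and> Vector_Spaces.linear scale scale q \<and>
    (\<forall>x. p x \<in> R) \<and> (\<forall>x\<in>R. p x = x) \<and> (\<forall>x. q x \<in> K) \<and> (\<forall>x\<in>K. q x = x) \<and>
    (\<forall>x. p (q x) = q (p x))"
proof -
  interpret vector_space_pair scale scale ..
  obtain e where e: "Vector_Spaces.linear scale scale e" "\<And>x. e x \<in> R" "\<And>x. e (e x) = e x"
    "\<And>x. x \<in> K \<Longrightarrow> e x = 0" "\<And>x. x \<in> R \<Longrightarrow> x - e x \<in> K"
    using ex_projection_complementing_inter[OF R K] by blast
  obtain g where g: "Vector_Spaces.linear scale scale g" "\<And>x. g x \<in> K" "\<And>x. x \<in> K \<Longrightarrow> g x = x"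
    using ex_projection[OF K] by blast
  obtain f where f: "Vector_Spaces.linear scale scale f" "\<And>x. f x \<in> R" "\<And>x. f x \<in> K"
    "\<And>x. x \<in> R \<Longrightarrow> x \<in> K \<Longrightarrow> f x = x"
    using ex_projection[OF subspace_inter[OF R K]] by blast
  \<comment> \<open>Subtracting \<open>e\<close> first makes \<open>q\<close> vanish on the range of
    \<open>e\<close>; on \<open>K\<close> nothing changes, since \<open>e\<close> is 0
    there.\<close>
  define q where "q = g \<circ> (\<lambda>x. x - e x)"
  \<comment> \<open>For \<open>x\<close> in \<open>R\<close>, \<open>q x\<close> is the remainder
    \<open>x - e x\<close>, which lies in \<open>R \<inter> K\<close> and is fixed by
    \<open>f\<close>.\<close>
  define p where "p = (\<lambda>x. e x + (f \<circ> q) x)"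
  have q: "Vector_Spaces.linear scale scale q"
    unfolding q_def by (rule Vector_Spaces.linear_compose[OF _ g(1)]) (intro linear_compose_sub linear_ident e(1))
  have p: "Vector_Spaces.linear scale scale p"
    unfolding p_def by (intro linear_compose_add e(1) Vector_Spaces.linear_compose[OF q f(1)])
  have qK: "q x \<in> K" and q_id: "x \<in> K \<Longrightarrow> q x = x" and qe: "q (e x) = 0" for x
    using g(2) by (simp_all add: q_def g(3) e(3,4) linear_0[OF g(1)])
  have "p x \<in> R" for x by (simp add: p_def subspace_add[OF R] e(2) f(2))
  moreover have "p x = x" if "x \<in> R" for x
  proof -
    have "q x = x - e x" using g(3)[OF e(5)[OF that]] by (simp add: q_def)
    then show ?thesis
      using that by (simp add: p_def f(4) e(2,5) subspace_diff[OF R])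
  qed
  \<comment> \<open>Both products equal \<open>f \<circ> q\<close>: \<open>e\<close> kills
    \<open>K\<close>, \<open>q\<close> kills the range of \<open>e\<close>, and \<open>q\<close>
    fixes the values of \<open>f\<close>.\<close>
  moreover have "p (q x) = q (p x)" for x
    by (simp add: p_def linear_add[OF q] qe e(4) qK q_id f(3))
  ultimately show ?thesis using p q qK q_id by blast
qed

end

lemma (in vector_space_pair) ex_inner_inverse:
  assumes "Vector_Spaces.linear s1 s2 T"
  shows "\<exists>H. Vector_Spaces.linear s2 s1 H \<and> (\<forall>x. T (H (T x)) = T x)"
  using linear_exists_right_inverse_on[OF assms vs1.subspace_UNIV] by blast

theorem theorem13:
  fixes sU :: "'k::field \<Rightarrow> 'u::ab_group_add \<Rightarrow> 'u"
    and sV :: "'k \<Rightarrow> 'v::ab_group_add \<Rightarrow> 'v"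
    and sW :: "'k \<Rightarrow> 'w::ab_group_add \<Rightarrow> 'w"
    and T1 :: "'v \<Rightarrow> 'w" and T2 :: "'u \<Rightarrow> 'v"
  assumes "vector_space sU" and "vector_space sV" and "vector_space sW"
    and "Vector_Spaces.linear sV sW T1" and "Vector_Spaces.linear sU sV T2"
  shows "\<exists>G1 G2. alg_gen_inverse sV sW T1 G1 \<and> alg_gen_inverse sU sV T2 G2 \<and>
    alg_gen_inverse sU sW (T1 \<circ> T2) (G2 \<circ> G1)"
proof -
  note T1 = assms(4) and T2 = assms(5)
  interpret V: vector_space sV by fact
  interpret VV: vector_space_pair sV sV ..
  interpret VW: vector_space_pair sV sW using assms by (simp add: vector_space_pair_def)
  interpret UV: vector_space_pair sU sV using assms by (simp add: vector_space_pair_def)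
  have R: "V.subspace (range T2)"
    using UV.linear_subspace_image[OF T2 UV.vs1.subspace_UNIV] .
  have K: "V.subspace {x. T1 x = 0}"
    using VW.linear_subspace_kernel[OF T1] .
  obtain p q where p: "Vector_Spaces.linear sV sV p" and q: "Vector_Spaces.linear sV sV q"
    and pR: "\<And>x. p x \<in> range T2" and pT2: "\<And>x. p (T2 x) = T2 x"
    and T1q: "\<And>x. T1 (q x) = 0" and q_id: "\<And>x. T1 x = 0 \<Longrightarrow> q x = x"
    and comm: "\<And>x. p (q x) = q (p x)"
    using V.ex_commuting_projections[OF R K] by blast
  obtain H1 where H1: "Vector_Spaces.linear sW sV H1" "\<And>x. T1 (H1 (T1 x)) = T1 x"
    using VW.ex_inner_inverse[OF T1] by blast
  obtain H2 where H2: "Vector_Spaces.linear sV sU H2" "\<And>x. T2 (H2 (T2 x)) = T2 x"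
    using UV.ex_inner_inverse[OF T2] by blast
  define r where "r = (\<lambda>x. x - q x)"
  have r: "Vector_Spaces.linear sV sV r"
    unfolding r_def by (intro VV.linear_compose_sub V.linear_ident q)
  have T1r: "T1 (r x) = T1 x" for x
    by (simp add: r_def VW.linear_diff[OF T1] T1q)
  \<comment> \<open>\<open>r\<close> vanishes on the kernel of \<open>T1\<close>, hence factors
    through \<open>T1\<close>; this turns \<open>r \<circ> H1 \<circ> T1\<close> into
    \<open>r\<close>.\<close>
  have r_eq: "r x = r y" if "T1 x = T1 y" for x y
  proof -
    have "r (x - y) = 0"
      using that by (simp add: r_def q_id VW.linear_diff[OF T1])
    then show ?thesis by (simp add: VV.linear_diff[OF r])
  qed
  have rH1: "r (H1 (T1 x)) = r x" and rr: "r (r x) = r x" for x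
    by (rule r_eq; simp add: H1(2) T1r)+
  have rp: "r (p x) = p (r x)" for x
    by (simp add: r_def VV.linear_diff[OF p] comm)
  have T2H2p: "T2 (H2 (p x)) = p x" and pp: "p (p x) = p x" for x
    using pR[of x] H2(2) pT2 by auto
  \<comment> \<open>By commutation \<open>r\<close> maps the range of \<open>p\<close> into the
    range of \<open>T2\<close>, where \<open>T2 \<circ> H2\<close> is the identity.\<close>
  have T2H2r: "T2 (H2 (r (p x))) = r (p x)" for x
    using T2H2p[of "r x"] by (simp add: rp)
  have T2H2rT2: "T2 (H2 (r (T2 x))) = r (T2 x)" for x
    using T2H2r[of "T2 x"] by (simp add: pT2)
  \<comment> \<open>The witnesses are \<open>r \<circ> H1\<close> for \<open>G1\<close> and
    \<open>H2 \<circ> p\<close> for \<open>G2\<close>: composing with the idempotents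
    \<open>r\<close> and \<open>p\<close> gives the inner inverses \<open>H1\<close> and
    \<open>H2\<close> the second identity \<open>GTG = G\<close>.\<close>
  have lin: "Vector_Spaces.linear sW sV (r \<circ> H1)" "Vector_Spaces.linear sV sU (H2 \<circ> p)"
    "Vector_Spaces.linear sU sW (T1 \<circ> T2)" "Vector_Spaces.linear sW sU ((H2 \<circ> p) \<circ> (r \<circ> H1))"
    using r H1(1) H2(1) p T1 T2 by (meson Vector_Spaces.linear_compose)+
  have "alg_gen_inverse sV sW T1 (r \<circ> H1)"
    unfolding alg_gen_inverse_def using T1 lin
    by (simp add: fun_eq_iff T1r H1(2) rH1 rr)
  moreover have "alg_gen_inverse sU sV T2 (H2 \<circ> p)"
    unfolding alg_gen_inverse_def using T2 lin
    by (simp add: fun_eq_iff T2H2p H2(2) pT2 pp)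
  moreover have "alg_gen_inverse sU sW (T1 \<circ> T2) ((H2 \<circ> p) \<circ> (r \<circ> H1))"
    unfolding alg_gen_inverse_def using lin
    by (simp add: fun_eq_iff T2H2r T2H2rT2 rH1 rr pp T1r pT2 rp[symmetric])
  ultimately show ?thesis by blast
qed

end
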